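(* Let $n$ be an integer greater than or equal to $2$. For $a\in(\mathbb Z/n\mathbb Z)\setminus\{0\}$, let $r=n/\gcd(n,a)$. Let $((\mathbb Z/n\mathbb Z)^{\mathbb Z^D},T)$ be a $D$-dimensional $n$-state linear cellular automaton, and let $((\mathbb Z/r\mathbb Z)^{\mathbb Z^D},T)$ be a $D$-dimensional $r$-state linear cellular automaton whose transition rule is the same as that of $((\mathbb Z/n\mathbb Z)^{\mathbb Z^D},T)$. Then the spatio-temporal patterns of the two cellular automata satisfy $$S_T(n,a)\cong S_T(r,1).$$
   Context: The dimension $D$ is any finite positive integer. For an integer $n\ge 2$, $\mathbb Z/n\mathbb Z=\{0,1,\dots,n-1\}$ is the additive group of residue classes of integers modulo $n$; $\gcd(n,a)$ is the greatest common divisor of $n$ and $a\in\{1,\dots,n-1\}$. Linear cellular automaton: let $m$ be a finite positive integer, $c_j\in\mathbb Z$ coefficients and $\boldsymbol v_j\in\mathbb Z^D$ vectors for $1\le j\le m$. The transition rule $T$ of a $D$-dimensional $n$-state linear cellular automaton $((\mathbb Z/n\mathbb Z)^{\mathbb Z^D},T)$ is given by $$(Tu)_{\boldsymbol i}=\sum_{j=1}^m c_j\,u_{\boldsymbol i+\boldsymbol v_j}\quad(\text{computed in }\mathbb Z/n\mathbb Z)$$ for $u=\{u_{\boldsymbol i}\}_{\boldsymbol i\in\mathbb Z^D}\in(\mathbb Z/n\mathbb Z)^{\mathbb Z^D}$. Automata with different numbers of states have the same transition rule $T$ when they are given by the same $m$, $c_j$, $\boldsymbol v_j$. $T^t$ is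 the $t$-fold composition of $T$, with $T^0u=u$. Single site seed: for $a\in(\mathbb Z/n\mathbb Z)\setminus\{0\}$, $u_{\langle a\rangle}\in(\mathbb Z/n\mathbb Z)^{\mathbb Z^D}$ is the configuration with $(u_{\langle a\rangle})_{\boldsymbol 0}=a$ and $(u_{\langle a\rangle})_{\boldsymbol i}=0$ for $\boldsymbol i\ne\boldsymbol 0$. The spatio-temporal pattern of the $n$-state automaton from the single site seed with $a$ is $\{T^tu_{\langle a\rangle}\}_{t=0}^\infty$. Isomorphic patterns: let $\Delta_T(n,a)$ be the subset of $\mathbb Z/n\mathbb Z$ consisting of those $b$ for which there exists $(\boldsymbol i,t)\in\mathbb Z^D\times\mathbb Z_{\ge0}$ with $(T^tu_{\langle a\rangle})_{\boldsymbol i}=b$. For $n,\hat n\ge2$, a $D$-dimensional $n$-state and a $D$-dimensional $\hat n$-state linear cellular automaton with the same transition rule $T$, and seeds $a\in(\mathbb Z/n\mathbb Z)\setminus\{0\}$, $\hat a\in(\mathbb Z/\hat n\mathbb Z)\setminus\{0\}$: if there exists an isomorphism $f:\Delta_T(n,a)\to\Delta_T(\hat n,\hat a)$ such that $f\big((T^tu_{\langle a\rangle})_{\boldsymbol i}\big)=(T^tu_{\langle\hat a\rangle})_{\boldsymbol i}$ for any site $\boldsymbol i\in\mathbb Z^D$ and any time step $t\in\mathbb Z_{\ge0}$, then the patterns $\{T^tu_{\langle a\rangle}\}_{t=0}^\infty$ and $\{T^tu_{\langle\hat a\rangle}\}_{t=0}^\infty$ are called isomorphic, and this relationship is denoted $S_T(n,a)\cong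 S_T(\hat n,\hat a)$. (The definition uses the word "isomorphism" for the map $f$ between these subsets without further specification.) *)

theory Defs
  imports "HOL-Algebra.Elementary_Groups" "HOL-Analysis.Finite_Cartesian_Product"
begin

text \<open>
  The additive group \<open>\<int>/n\<int>\<close> is \<^const>\<open>integer_mod_group\<close>, whose elements are the
  representatives \<open>0, \<dots>, n - 1\<close> of type \<^typ>\<open>int\<close>.  The lattice \<open>\<int>\<^sup>D\<close> is the type
  \<open>int ^ 'd\<close> with \<open>D = CARD('d)\<close>.  Configurations are functions on the lattice with
  values in the carrier of \<^const>\<open>integer_mod_group\<close>.
\<close>

type_synonym 'd configuration = "int ^ 'd \<Rightarrow> int"

text \<open>
  The integer data \<open>m\<close>, \<open>c\<close>, \<open>v\<close> (with \<open>c j\<close>, \<open>v j\<close> relevant for \<open>1 \<le> j \<le> m\<close> only) do not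
  depend on the number \<open>n\<close> of states, so that two automata have the same transition rule when
  they are given by the same \<open>m\<close>, \<open>c\<close>, \<open>v\<close>.
\<close>

definition lca_step ::
  "nat \<Rightarrow> (nat \<Rightarrow> int) \<Rightarrow> (nat \<Rightarrow> int ^ 'd) \<Rightarrow> nat \<Rightarrow> 'd::finite configuration \<Rightarrow> 'd configuration"
  where "lca_step m c v n u = (\<lambda>i. (\<Sum>j = 1..m. c j * u (i + v j)) mod int n)"

definition single_site_seed :: "int \<Rightarrow> 'd::finite configuration"
  where "single_site_seed a = (\<lambda>i. if i = 0 then a else 0)"

definition pattern ::
  "nat \<Rightarrow> (nat \<Rightarrow> int) \<Rightarrow> (nat \<Rightarrow> int ^ 'd) \<Rightarrow> nat \<Rightarrow> int \<Rightarrow> nat \<Rightarrow> 'd::finite configuration"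
  where "pattern m c v n a t = (lca_step m c v n ^^ t) (single_site_seed a)"

definition pattern_values ::
  "nat \<Rightarrow> (nat \<Rightarrow> int) \<Rightarrow> (nat \<Rightarrow> int ^ 'd::finite) \<Rightarrow> nat \<Rightarrow> int \<Rightarrow> int set"
  where "pattern_values m c v n a =
    {b \<in> carrier (integer_mod_group n). \<exists>i t. pattern m c v n a t i = b}"

text \<open>
  The sets of values of two patterns are mere subsets of additive groups, in general not
  subgroups.  An isomorphism between them is understood as a bijection that is the restriction
  of a group isomorphism between the subgroups they generate.  Multiplication is not involved:
  for \<open>n = 4\<close>, \<open>a = 2\<close> and \<open>n' = 2\<close>, \<open>a' = 1\<close>, say, \<open>f a = a'\<close> is incompatible with it.
\<close>

definition isomorphic_patterns ::
  "nat \<Rightarrow> (nat \<Rightarrow> int) \<Rightarrow> (nat \<Rightarrow> int ^ 'd::finite) \<Rightarrow> nat \<Rightarrow> int \<Rightarrow> nat \<Rightarrow> int \<Rightarrow> bool"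
  where "isomorphic_patterns m c v n a n' a' \<longleftrightarrow>
    n \<ge> 2 \<and> a \<in> carrier (integer_mod_group n) - {0} \<and>
    n' \<ge> 2 \<and> a' \<in> carrier (integer_mod_group n') - {0} \<and>
    (\<exists>f. bij_betw f (pattern_values m c v n a) (pattern_values m c v n' a') \<and>
         f \<in> iso (subgroup_generated (integer_mod_group n) (pattern_values m c v n a))
                 (subgroup_generated (integer_mod_group n') (pattern_values m c v n' a')) \<and>
         (\<forall>i t. f (pattern m c v n a t i) = pattern m c v n' a' t i))"

end

(* The r-state pattern with seed 1 is mapped onto the n-state pattern with seed a by
   multiplication by a, since this commutes with the transition rule.  As the order of a
   in Z/nZ is r, multiplication by a is an embedding of Z/rZ into Z/nZ, and the isomorphism
   is its inverse on the subgroup generated by the values of the pattern. *)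
theory Submission
  imports Defs
begin

lemma pattern_in_carrier:
  assumes "k \<ge> 1" and "b \<in> carrier (integer_mod_group k)"
  shows "pattern m c v k b t i \<in> carrier (integer_mod_group k)"
  using assms
  by (cases t)
    (auto simp: pattern_def lca_step_def single_site_seed_def carrier_integer_mod_group)

lemma pattern_values_eq:
  assumes "k \<ge> 1" and "b \<in> carrier (integer_mod_group k)"
  shows "pattern_values m c v k b = range (\<lambda>(i, t). pattern m c v k b t i)"
  using pattern_in_carrier[OF assms] by (fastforce simp: pattern_values_def)

text \<open>Multiplication by \<open>a\<close> sends multiples of \<open>r\<close> to multiples of
  \<open>n\<close>, so it is well defined from residues modulo \<open>r\<close> to residues modulo
  \<open>n\<close>. This is what lets an inner reduction modulo \<open>r\<close> be inserted or
  dropped.\<close>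

lemma mult_mod_cong_of_dvd:
  fixes a x y :: int
  assumes "int n dvd a * int r" and "x mod int r = y mod int r"
  shows "a * x mod int n = a * y mod int n"
proof -
  have "a * int r dvd a * (x - y)"
    using assms(2) by (simp add: mod_eq_dvd_iff)
  with assms(1) have "int n dvd a * x - a * y"
    by (metis dvd_trans right_diff_distrib)
  then show ?thesis by (simp add: mod_eq_dvd_iff)
qed

text \<open>By linearity the factor \<open>a\<close> can be pulled out of each time step. At time 0
  no reduction has taken place, so the seed itself must be a reduced representative.\<close>

lemma pattern_mult:
  assumes "int n dvd a * int r" and "a mod int n = a"
  shows "pattern m c v n a t i = a * pattern m c v r 1 t i mod int n"
proof (induction t arbitrary: i)
  case 0
  with assms(2) show ?case by (simp add: pattern_def single_site_seed_def)
next
  case (Suc t)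
  let ?P = "pattern m c v r 1 t"
  have "pattern m c v n a (Suc t) i = (\<Sum>j = 1..m. c j * pattern m c v n a t (i + v j)) mod int n"
    by (simp add: pattern_def lca_step_def)
  also have "\<dots> = (\<Sum>j = 1..m. c j * (a * ?P (i + v j) mod int n) mod int n) mod int n"
    by (simp add: Suc.IH mod_sum_eq)
  also have "\<dots> = (\<Sum>j = 1..m. a * (c j * ?P (i + v j))) mod int n"
    by (simp add: mod_mult_right_eq mod_sum_eq mult.left_commute)
  also have "\<dots> = a * (\<Sum>j = 1..m. c j * ?P (i + v j)) mod int n"
    by (simp add: sum_distrib_left)
  \<comment> \<open>The step of the automaton with \<open>r\<close> states reduces modulo
    \<open>r\<close>; under the factor \<open>a\<close> this is invisible modulo
    \<open>n\<close>.\<close>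
  also have "\<dots> = a * ((\<Sum>j = 1..m. c j * ?P (i + v j)) mod int r) mod int n"
    by (rule mult_mod_cong_of_dvd[OF assms(1)]) simp
  also have "\<dots> = a * pattern m c v r 1 (Suc t) i mod int n"
    by (simp add: pattern_def lca_step_def)
  finally show ?case .
qed

lemma mult_hom_integer_mod_group:
  assumes "n \<ge> 1" and "int n dvd a * int r"
  shows "(\<lambda>x. a * x mod int n) \<in> hom (integer_mod_group r) (integer_mod_group n)"
proof (rule homI)
  fix x y
  have "a * ((x + y) mod int r) mod int n = a * (x + y) mod int n"
    by (rule mult_mod_cong_of_dvd[OF assms(2)]) simp
  then show "a * (x \<otimes>\<^bsub>integer_mod_group r\<^esub> y) mod int n =
      (a * x mod int n) \<otimes>\<^bsub>integer_mod_group n\<^esub> (a * y mod int n)"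
    by (simp add: distrib_left mod_add_eq)
qed (use assms(1) in \<open>simp add: carrier_integer_mod_group\<close>)

text \<open>The second assumption says that the kernel is trivial; congruent elements then coincide
  because the carrier holds one representative per class.\<close>

lemma mult_inj_integer_mod_group:
  assumes "r \<ge> 1" and "\<And>x. int n dvd a * x \<Longrightarrow> int r dvd x"
  shows "inj_on (\<lambda>x. a * x mod int n) (carrier (integer_mod_group r))"
proof (rule inj_onI)
  fix x y
  assume xy: "x \<in> carrier (integer_mod_group r)" "y \<in> carrier (integer_mod_group r)"
    and "a * x mod int n = a * y mod int n"
  then have "int n dvd a * (x - y)"
    by (simp add: mod_eq_dvd_iff right_diff_distrib)
  then have "x mod int r = y mod int r"
    by (simp add: assms(2) mod_eq_dvd_iff)
  with xy assms(1) show "x = y"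
    by (simp add: carrier_integer_mod_group)
qed

text \<open>A homomorphism maps the subgroup generated by a set onto the one generated by its image,
  and injectivity is inherited from the whole group.\<close>

lemma (in group_hom) iso_subgroup_generated_image:
  assumes "inj_on h (carrier G)" and "S \<subseteq> carrier G"
  shows "h \<in> iso (subgroup_generated G S) (subgroup_generated H (h ` S))"
  using assms
  by (metis G.carrier_subgroup_generated_subset Group.iso_iff hom_between_subgroups
      inj_on_subset subgroup_generated_by_image order_refl)

theorem theorem1:
  fixes n r m :: nat and a :: int
    and c :: "nat \<Rightarrow> int" and v :: "nat \<Rightarrow> int ^ 'd::finite"
  assumes "n \<ge> 2"
    and "a \<in> carrier (integer_mod_group n) - {0}"
    and "r = n div nat (gcd (int n) a)"
    and "m \<ge> 1"
  shows "isomorphic_patterns m c v n a r 1"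
proof -
  define g where "g = gcd (int n) a"
  have a: "0 < a" "a < int n"
    using assms(1,2) by (auto simp: carrier_integer_mod_group)
  have "g > 0" using a by (simp add: g_def)
  obtain b where b: "a = g * b" by (metis dvdE gcd_dvd2 g_def)
  have "int r = int n div g"
    using \<open>g > 0\<close> by (simp add: assms(3) zdiv_int flip: g_def)
  then have n: "int n = g * int r" by (simp add: g_def)
  \<comment> \<open>Taking the common factor \<open>g\<close> out of
    \<open>gcd (int n) a = g\<close> leaves \<open>gcd (int r) b = 1\<close>.\<close>
  have "coprime (int r) b"
  proof -
    have "g * gcd (int r) b = g"
      using \<open>g > 0\<close> by (metis abs_of_pos b g_def gcd_mult_distrib_int n)
    with \<open>g > 0\<close> show ?thesis by (simp add: coprime_iff_gcd_eq_1)
  qed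
  \<comment> \<open>The case \<open>r = 1\<close> would give \<open>n = g \<le> a < n\<close>, and
    \<open>r = 0\<close> would give \<open>n = 0\<close>.\<close>
  have "g \<le> a" using a(1) by (simp add: g_def zdvd_imp_le)
  then have "r \<ge> 2"
    using a n \<open>g > 0\<close> by (cases "r = 0 \<or> r = 1") auto
  have dvd: "int n dvd a * int r"
    by (simp add: n b)
  \<comment> \<open>Cancelling \<open>g\<close> leaves \<open>r\<close> dividing
    \<open>b * x\<close>, with \<open>r\<close> coprime to \<open>b\<close>.\<close>
  have dvdD: "int r dvd x" if "int n dvd a * x" for x
    using that \<open>g > 0\<close> \<open>coprime (int r) b\<close>
    by (simp add: n b mult.assoc coprime_dvd_mult_right_iff)

  let ?R = "integer_mod_group r" and ?N = "integer_mod_group n"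
  let ?V = "pattern_values m c v r 1" and ?W = "pattern_values m c v n a"
  define h where "h x = a * x mod int n" for x
  have pat: "pattern m c v n a t i = h (pattern m c v r 1 t i)" for t i
    unfolding h_def using a by (intro pattern_mult dvd) simp
  have one: "1 \<in> carrier ?R" using \<open>r \<ge> 2\<close> by simp
  have W: "?W = h ` ?V"
    using assms(1,2) \<open>r \<ge> 2\<close> one
    by (auto simp: pattern_values_eq pat image_image case_prod_unfold)
  have V: "?V \<subseteq> carrier ?R" by (auto simp: pattern_values_def)
  have inj: "inj_on h (carrier ?R)"
    unfolding h_def using \<open>r \<ge> 2\<close> dvdD by (intro mult_inj_integer_mod_group) auto
  interpret group_hom ?R ?N h
    unfolding group_hom_def group_hom_axioms_def h_def
    using assms(1) dvd by (simp add: mult_hom_integer_mod_group)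
  let ?G = "subgroup_generated ?R ?V"
  \<comment> \<open>Inverting on the whole generated subgroup, not only on the values, makes
    \<open>f\<close> a group isomorphism; on the values it still undoes \<open>h\<close>, since they
    lie in that subgroup.\<close>
  define f where "f = inv_into (carrier ?G) h"
  have iso: "h \<in> iso ?G (subgroup_generated ?N ?W)"
    unfolding W by (rule iso_subgroup_generated_image[OF inj V])
  then have f_iso: "f \<in> iso (subgroup_generated ?N ?W) ?G"
    unfolding f_def by (rule group.iso_set_sym[OF G.group_subgroup_generated])
  have VG: "?V \<subseteq> carrier ?G"
    by (rule G.subgroup_generated_subset_carrier_subset[OF V])
  have fh: "f (h x) = x" if "x \<in> ?V" for x
    unfolding f_def using iso VG that by (auto simp: Group.iso_iff)
  have "f (pattern m c v n a t i) = pattern m c v r 1 t i" for i t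
    unfolding pat using \<open>r \<ge> 2\<close> one by (intro fh) (auto simp: pattern_values_eq)
  moreover have "bij_betw f ?W ?V"
    unfolding W by (rule bij_betw_byWitness[where f' = h]) (auto simp: fh)
  ultimately show ?thesis
    unfolding isomorphic_patterns_def using assms(1,2) \<open>r \<ge> 2\<close> one f_iso by auto
qed

end
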